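(* For every positive integer $k$ there is a finite graph $G$ with $\mathcal{L}(G)\le 3$ and $\operatorname{pw}(G)\ge k$.
   Context: Lions and contamination game. Let $G=(V,E)$ be a finite graph, $N(v)$ the set of neighbours of $v$. A lion strategy with $k\ge 1$ lions consists of initial positions $p_1(0),\dots,p_k(0)\in V$ and, for each $t\ge 1$, positions $p_i(t)\in\{p_i(t-1)\}\cup N(p_i(t-1))$. Put $L_t=\{p_i(t)\}_i$, $\pi_t=\{(p_i(t-1),p_i(t))\}_i$. Contaminated sets: $W_0=V\setminus L_0$, and for $t\ge1$, $W_t=(W_{t-1}\setminus L_t)\cup\{v\in V\setminus L_t:\exists w\in W_{t-1}\cap N(v)\text{ with }(v,w)\notin\pi_t,(w,v)\notin\pi_t\}$. The strategy clears $G$ if $W_T=\emptyset$ for some $T$; $\mathcal{L}(G)$ is the minimum number of lions of a clearing strategy. $\operatorname{pw}(G)$ denotes the pathwidth of $G$. *)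

theory Defs
  imports "Graph_Theory.Pair_Digraph"
begin

text \<open>
  Finite simple graphs are the symmetric loop-free digraphs of the locale \<open>pair_graph\<close>: an
  undirected edge between \<open>u\<close> and \<open>v\<close> is represented by the two pairs \<open>(u, v)\<close> and \<open>(v, u)\<close>.
\<close>

definition neighbours :: "'a pair_pre_digraph \<Rightarrow> 'a \<Rightarrow> 'a set" where
  "neighbours G v = {w. (v, w) \<in> parcs G}"

text \<open>Lions are indexed by \<open>i < k\<close>, and \<open>p i t\<close> is the position of lion \<open>i\<close> at time \<open>t\<close>.\<close>

definition lion_strategy :: "'a pair_pre_digraph \<Rightarrow> nat \<Rightarrow> (nat \<Rightarrow> nat \<Rightarrow> 'a) \<Rightarrow> bool" where
  "lion_strategy G k p \<longleftrightarrow>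
     (\<forall>i<k. p i 0 \<in> pverts G) \<and>
     (\<forall>i<k. \<forall>t. p i (Suc t) \<in> {p i t} \<union> neighbours G (p i t))"

definition lion_set :: "nat \<Rightarrow> (nat \<Rightarrow> nat \<Rightarrow> 'a) \<Rightarrow> nat \<Rightarrow> 'a set" where
  "lion_set k p t = {p i t | i. i < k}"

text \<open>\<open>lion_moves k p t\<close> collects the moves made between the times \<open>t\<close> and \<open>t + 1\<close>.\<close>

definition lion_moves :: "nat \<Rightarrow> (nat \<Rightarrow> nat \<Rightarrow> 'a) \<Rightarrow> nat \<Rightarrow> ('a \<times> 'a) set" where
  "lion_moves k p t = {(p i t, p i (Suc t)) | i. i < k}"

primrec contaminated ::
  "'a pair_pre_digraph \<Rightarrow> nat \<Rightarrow> (nat \<Rightarrow> nat \<Rightarrow> 'a) \<Rightarrow> nat \<Rightarrow> 'a set" where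
  "contaminated G k p 0 = pverts G - lion_set k p 0"
| "contaminated G k p (Suc t) =
     (contaminated G k p t - lion_set k p (Suc t)) \<union>
     {v \<in> pverts G - lion_set k p (Suc t).
        \<exists>w \<in> contaminated G k p t \<inter> neighbours G v.
          (v, w) \<notin> lion_moves k p t \<and> (w, v) \<notin> lion_moves k p t}"

definition clears :: "'a pair_pre_digraph \<Rightarrow> nat \<Rightarrow> (nat \<Rightarrow> nat \<Rightarrow> 'a) \<Rightarrow> bool" where
  "clears G k p \<longleftrightarrow> (\<exists>T. contaminated G k p T = {})"

definition lion_number :: "'a pair_pre_digraph \<Rightarrow> nat" where
  "lion_number G = (LEAST k. k \<ge> 1 \<and> (\<exists>p. lion_strategy G k p \<and> clears G k p))"

definition path_decomposition :: "'a pair_pre_digraph \<Rightarrow> 'a set list \<Rightarrow> bool" where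
  "path_decomposition G Xs \<longleftrightarrow>
     Xs \<noteq> [] \<and>
     \<Union> (set Xs) = pverts G \<and>
     (\<forall>(u, v) \<in> parcs G. \<exists>X \<in> set Xs. u \<in> X \<and> v \<in> X) \<and>
     (\<forall>i j l. i \<le> j \<and> j \<le> l \<and> l < length Xs \<longrightarrow> Xs ! i \<inter> Xs ! l \<subseteq> Xs ! j)"

text \<open>Widths are integers, so that the graph without vertices has pathwidth \<open>-1\<close>.\<close>

definition decomposition_width :: "'a set list \<Rightarrow> int" where
  "decomposition_width Xs = int (Max (card ` set Xs)) - 1"

definition pathwidth :: "'a pair_pre_digraph \<Rightarrow> int" where
  "pathwidth G =
     (LEAST w. \<exists>Xs. path_decomposition G Xs \<and> decomposition_width Xs = w)"

text \<open>
  The two minima are attained; for the lion number this needs a vertex, as a strategy has at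
  least one lion.
\<close>

lemma lion_number_attained:
  assumes "pair_graph G" and "pverts G \<noteq> {}"
  shows "lion_number G \<ge> 1 \<and>
    (\<exists>p. lion_strategy G (lion_number G) p \<and> clears G (lion_number G) p)"
proof -
  interpret pair_graph G by fact
  obtain f where f: "bij_betw f {0..<card (pverts G)} (pverts G)"
    using ex_bij_betw_nat_finite[OF pair_finite_verts] by blast
  define p where "p = (\<lambda>i (t::nat). f i)"
  have "lion_set (card (pverts G)) p 0 = pverts G"
  proof -
    have "lion_set (card (pverts G)) p 0 = f ` {0..<card (pverts G)}"
      by (auto simp: lion_set_def p_def)
    then show ?thesis
      using f by (simp add: bij_betw_def)
  qed
  then have "clears G (card (pverts G)) p"
    unfolding clears_def by (intro exI[of _ 0]) simp
  moreover have "lion_strategy G (card (pverts G)) p"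
    using f by (auto simp: lion_strategy_def p_def bij_betw_def)
  moreover have "card (pverts G) \<ge> 1"
    using assms(2) pair_finite_verts by (simp add: Suc_leI card_gt_0_iff)
  ultimately have "\<exists>k. k \<ge> 1 \<and> (\<exists>p. lion_strategy G k p \<and> clears G k p)"
    by blast
  then show ?thesis
    unfolding lion_number_def by (rule LeastI_ex)
qed

lemma pathwidth_attained:
  assumes "pair_graph G"
  obtains Xs where "path_decomposition G Xs" and "decomposition_width Xs = pathwidth G"
    and "\<And>Ys. path_decomposition G Ys \<Longrightarrow> pathwidth G \<le> decomposition_width Ys"
proof -
  interpret pair_graph G by fact
  define P where "P = (\<lambda>n. \<exists>Xs. path_decomposition G Xs \<and> Max (card ` set Xs) = n)"
  have "path_decomposition G [pverts G]"
    by (auto simp: path_decomposition_def dest: in_arcsD1 in_arcsD2)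
  then have "P (card (pverts G))"
    unfolding P_def by (intro exI[of _ "[pverts G]"]) simp
  then have "P (LEAST n. P n)"
    by (rule LeastI)
  then obtain Xs where Xs: "path_decomposition G Xs" "Max (card ` set Xs) = (LEAST n. P n)"
    by (auto simp: P_def)
  have least: "decomposition_width Xs \<le> decomposition_width Ys"
    if "path_decomposition G Ys" for Ys
  proof -
    have "P (Max (card ` set Ys))"
      using that by (auto simp: P_def)
    then have "Max (card ` set Xs) \<le> Max (card ` set Ys)"
      unfolding Xs(2) by (rule Least_le)
    then show ?thesis
      by (simp add: decomposition_width_def)
  qed
  have "pathwidth G = decomposition_width Xs"
    unfolding pathwidth_def
    by (rule Least_equality) (use Xs least in auto)
  then show ?thesis
    using that[of Xs] Xs least by simp
qed

end

theory Submission
  imports Defs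
begin

text \<open>
  The graph is a tree together with an apex adjacent to all of its vertices. One lion never leaves
  the apex, so contamination has to walk inside the tree while the two other lions jump between
  any two vertices in two steps. The trees are built recursively: three trees that the lions can
  already clear are joined to a new root by paths of very different lengths. The lions clear the
  tree at the end of the longest path and sweep that path up to the root, then do the same for the
  middle and for the short path. Each path is so long that what is cleared later is finished before
  recontamination from the root has reached its far end. At last one lion guards the root and the
  other one sweeps the middle and the long path again, each from its clean end to the root.
  Joining three disjoint copies increases the pathwidth: of three bags that are large on one copy
  each, the middle one also meets the connected union of the two other copies and their paths.
\<close>

section \<open>Clearing a graph with an apex\<close>

text \<open>In a branch \<open>p 0\<close> already lies in \<open>A\<close>, so index 1 gives
  \<open>A\<close> alone and index \<open>Suc l\<close> adds the whole path with its root end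
  \<open>p l\<close>.\<close>

definition part :: "'a set \<Rightarrow> (nat \<Rightarrow> 'a) \<Rightarrow> nat \<Rightarrow> 'a set" where
  "part A p m = A \<union> p ` {..<m}"

lemma part_mono: "m \<le> m' \<Longrightarrow> part A p m \<subseteq> part A p m'"
  by (auto simp: part_def)

locale cone_game =
  fixes V :: "'a set" and F :: "('a \<times> 'a) set" and h :: 'a
  assumes finV: "finite V" and hV: "h \<notin> V" and FV: "F \<subseteq> V \<times> V"
    and symF: "sym F" and irrF: "irrefl F"
begin

definition cone :: "'a pair_pre_digraph" where
  "cone = \<lparr>pverts = insert h V, parcs = F \<union> {h} \<times> V \<union> V \<times> {h}\<rparr>"

text \<open>
  A state consists of the positions of the two mobile lions and the contaminated set; the third
  lion stays on the apex, hence the apex is never contaminated.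
\<close>

fun step :: "'a \<times> 'a \<times> 'a set \<Rightarrow> 'a \<times> 'a \<times> 'a set \<Rightarrow> bool" where
  "step (a, b, W) (a', b', W') \<longleftrightarrow>
     a' \<in> insert a (neighbours cone a) \<and> b' \<in> insert b (neighbours cone b) \<and>
     W' = {v \<in> V - {a', b'}. v \<in> W \<or>
       (\<exists>w\<in>W. (v, w) \<in> F \<and> (v, w) \<notin> {(a, a'), (b, b')} \<and> (w, v) \<notin> {(a, a'), (b, b')})}"

text \<open>Steps in which the first mobile lion stays put as a guard.\<close>

definition gstep :: "'a \<times> 'a \<times> 'a set \<Rightarrow> 'a \<times> 'a \<times> 'a set \<Rightarrow> bool" where
  "gstep s s' \<longleftrightarrow> step s s' \<and> fst s' = fst s"

section \<open>Moves of the mobile lions and jumps through the apex\<close>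

lemma neighbours_cone:
  "neighbours cone v = F `` {v} \<union> (if v = h then V else {}) \<union> (if v \<in> V then {h} else {})"
  by (auto simp: neighbours_def cone_def)

lemma pair_graph_cone: "pair_graph cone"
proof
  show "finite (pverts cone)" using finV by (simp add: cone_def)
  have "finite F" using FV finV by (meson finite_SigmaI finite_subset)
  then show "finite (parcs cone)" using finV by (simp add: cone_def)
  show "symmetric (with_proj cone)"
    using symF by (auto simp: symmetric_def cone_def sym_def)
next
  fix e assume "e \<in> parcs cone"
  then show "fst e \<in> pverts cone" "snd e \<in> pverts cone" "fst e \<noteq> snd e"
    using FV irrF hV by (auto simp: cone_def irrefl_def)
qed

text \<open>The mobile lions are interchangeable, so either of them may act as the guard of
  \<open>gstep\<close>.\<close>

lemma relpowp_swap:
  "(step ^^ n) (a, b, W) (a', b', W') \<Longrightarrow> (step ^^ n) (b, a, W) (b', a', W')"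
proof (induction n arbitrary: a' b' W')
  case (Suc n)
  then obtain c d U where "(step ^^ n) (a, b, W) (c, d, U)" and s: "step (c, d, U) (a', b', W')"
    by (auto elim!: relpowp_Suc_E)
  with Suc.IH have "(step ^^ n) (b, a, W) (d, c, U)" by blast
  moreover have "step (d, c, U) (b', a', W')" using s by auto
  ultimately show ?case by auto
qed auto

lemma relpowp_gstep: "(gstep ^^ n) s s' \<Longrightarrow> (step ^^ n) s s'"
  by (rule relpowp_mono[of gstep]) (auto simp: gstep_def)

lemma relpowp_positions:
  assumes "(step ^^ n) (a, b, W) (a', b', W')" "a \<in> insert h V" "b \<in> insert h V"
  shows "a' \<in> insert h V \<and> b' \<in> insert h V"
  using assms
proof (induction n arbitrary: a' b' W')
  case (Suc n)
  then obtain c d U where "(step ^^ n) (a, b, W) (c, d, U)" and s: "step (c, d, U) (a', b', W')"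
    by (auto elim!: relpowp_Suc_E)
  with Suc have "c \<in> insert h V \<and> d \<in> insert h V" by blast
  with s show ?case using FV by (auto simp: neighbours_cone split: if_splits)
qed auto

lemma teleport:
  assumes "a \<in> insert h V" "b \<in> insert h V" "c \<in> insert h V"
  shows "\<exists>W'. (step ^^ 2) (a, b, W) (c, b, W') \<and> c \<notin> W'"
proof -
  obtain U where U: "step (a, b, W) (h, b, U)"
    using assms by (auto simp: neighbours_cone)
  obtain W' where "step (h, b, U) (c, b, W')" "c \<notin> W'"
    using assms by (auto simp: neighbours_cone)
  with U show ?thesis
    using relpowp_Suc_I[OF relpowp_Suc_I[OF relpowp_0_I]] unfolding numeral_2_eq_2 by metis
qed

lemma teleport_guarded:
  assumes "b \<in> insert h V" "c \<in> insert h V"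
  shows "\<exists>W'. (gstep ^^ 2) (a, b, W) (a, c, W')"
proof -
  obtain U where U: "gstep (a, b, W) (a, h, U)"
    using assms by (auto simp: neighbours_cone gstep_def)
  obtain W' where "gstep (a, h, U) (a, c, W')"
    using assms by (auto simp: neighbours_cone gstep_def)
  with U show ?thesis by (auto simp: numeral_2_eq_2)
qed

text \<open>Start positions and contamination are arbitrary and the time bound is uniform: a part
  gets cleared in the midst of a longer strategy, and path lengths are chosen from the bound
  alone.\<close>

definition clearable :: "'a set \<Rightarrow> 'a \<Rightarrow> nat \<Rightarrow> bool" where
  "clearable A r \<tau> \<longleftrightarrow> (\<forall>a b W. a \<in> insert h V \<longrightarrow> b \<in> insert h V \<longrightarrow>
     (\<exists>n\<le>\<tau>. \<exists>b' W'. (step ^^ n) (a, b, W) (r, b', W') \<and> W' \<inter> A = {}))"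

lemma clearable_singleton: "r \<in> V \<Longrightarrow> clearable {r} r 2"
  unfolding clearable_def using teleport[of _ _ r] by fastforce

section \<open>Spread, sweep and guard on a branch\<close>

text \<open>
  The set \<open>A\<close> is attached at \<open>p 0\<close> to a path \<open>p 0, \<dots>, p l\<close>; apart from the apex, the rest of the
  graph is reached only through \<open>p l\<close>.
\<close>

definition branch :: "'a set \<Rightarrow> (nat \<Rightarrow> 'a) \<Rightarrow> nat \<Rightarrow> bool" where
  "branch A p l \<longleftrightarrow> p 0 \<in> A \<and> (\<forall>v\<in>A - {p 0}. F `` {v} \<subseteq> A) \<and> F `` {p 0} \<subseteq> A \<union> {p 1} \<and>
     (\<forall>j. 0 < j \<and> j < l \<longrightarrow> F `` {p j} \<subseteq> {p (j - 1), p (Suc j)}) \<and>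
     (\<forall>j<l. (p j, p (Suc j)) \<in> F)"

lemma part_1: "branch A p l \<Longrightarrow> part A p (Suc 0) = A"
  by (auto simp: part_def branch_def)

text \<open>The fact behind decay, sweep and guard: contamination can enter
  \<open>part A p m\<close> only from the next path vertex \<open>p m\<close>.\<close>

lemma part_neighbours:
  assumes "branch A p l" "1 \<le> m" "m \<le> l" "v \<in> part A p m" "(v, w) \<in> F"
  shows "w \<in> part A p (Suc m)"
proof (cases "v \<in> A - {p 0}")
  case True
  then show ?thesis using assms by (auto simp: branch_def part_def)
next
  case False
  then obtain j where j: "v = p j" "j < m" using assms by (auto simp: part_def)
  show ?thesis
  proof (cases "j = 0")
    case True
    then have "w \<in> A \<union> {p 1}" using assms j by (auto simp: branch_def)
    then show ?thesis using assms(2) by (auto simp: part_def)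
  next
    case False
    then have "w \<in> {p (j - 1), p (Suc j)}" using assms j by (auto simp: branch_def)
    then show ?thesis using j by (auto simp: part_def)
  qed
qed

text \<open>Wherever the lions are, contamination advances by at most one path vertex per step
  towards \<open>A\<close>, so the clean index falls by at most the elapsed time.\<close>

lemma part_decay:
  assumes "branch A p l" "(step ^^ n) (a, b, W) (a', b', W')"
    and "W \<inter> part A p M = {}" "1 \<le> m" "m + n \<le> M" "M \<le> Suc l"
  shows "W' \<inter> part A p m = {}"
  using assms(2,4,5)
proof (induction n arbitrary: a' b' W' m)
  case 0
  then show ?case using assms(3) part_mono[of m M A p] by auto
next
  case (Suc n)
  then obtain c d U where "(step ^^ n) (a, b, W) (c, d, U)" and s: "step (c, d, U) (a', b', W')"
    by (auto elim!: relpowp_Suc_E)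
  with Suc have U: "U \<inter> part A p (Suc m) = {}" by auto
  have "v \<notin> W'" if "v \<in> part A p m" for v
    using s U that part_neighbours[OF assms(1) Suc.prems(2) _ that] part_mono[of m "Suc m" A p]
      Suc.prems assms(6) by auto
  then show ?case by auto
qed

text \<open>The lion always crosses the one edge from the clean part to the next path vertex, and
  contamination cannot pass an edge while a lion traverses it.\<close>

lemma part_sweep:
  assumes "branch A p l" "W \<inter> A = {}" "j \<le> l"
  shows "\<exists>W'. (gstep ^^ j) (c, p 0, W) (c, p j, W') \<and> W' \<inter> part A p (Suc j) = {}"
  using assms(3)
proof (induction j)
  case 0
  then show ?case using assms part_1[OF assms(1)] by auto
next
  case (Suc j)
  then obtain U where U: "(gstep ^^ j) (c, p 0, W) (c, p j, U)" "U \<inter> part A p (Suc j) = {}"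
    by auto
  have e: "(p j, p (Suc j)) \<in> F" using assms Suc by (auto simp: branch_def)
  then obtain W' where s: "step (c, p j, U) (c, p (Suc j), W')"
    by (auto simp: neighbours_cone)
  have "v \<notin> W'" if v: "v \<in> part A p (Suc (Suc j))" for v
  proof
    assume vW: "v \<in> W'"
    then have "v \<noteq> p (Suc j)" using s by auto
    then have v': "v \<in> part A p (Suc j)" using v by (auto simp: part_def less_Suc_eq)
    then have "v \<notin> U" using U by auto
    then obtain w where w: "w \<in> U" "(v, w) \<in> F" "(v, w) \<noteq> (p j, p (Suc j))"
      using vW s by auto
    have "w \<notin> part A p (Suc j)" using w U by auto
    moreover have "w \<in> part A p (Suc (Suc j))"
      using part_neighbours[OF assms(1) _ _ v' w(2)] Suc.prems by auto
    ultimately have wp: "w = p (Suc j)" by (auto simp: part_def less_Suc_eq)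
    \<comment> \<open>It remains to see that \<open>v\<close> is \<open>p j\<close>, so that the
      edge is the one being crossed. For \<open>j = 0\<close> the vertex lies in \<open>A\<close>,
      where only \<open>p 0\<close> has a neighbour outside; otherwise \<open>part A p j\<close> is
      too far from \<open>p (Suc j)\<close>.\<close>
    show False
    proof (cases "j = 0")
      case True
      then show ?thesis
        using v' w wp assms(1) \<open>w \<notin> part A p (Suc j)\<close> by (auto simp: part_def branch_def)
    next
      case False
      then have "v \<notin> part A p j"
        using part_neighbours[OF assms(1) _ _ _ w(2), of j] \<open>w \<notin> part A p (Suc j)\<close> Suc.prems
        by auto
      then have "v = p j" using v' by (auto simp: part_def less_Suc_eq)
      then show ?thesis using w wp by auto
    qed
  qed
  moreover have "gstep (c, p j, U) (c, p (Suc j), W')"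
    using s by (simp add: gstep_def del: step.simps)
  ultimately show ?case using relpowp_Suc_I[OF U(1)] by blast
qed

text \<open>The branch can be entered only through \<open>p l\<close>, which the guard
  occupies.\<close>

lemma part_guarded:
  assumes "branch A p l" "1 \<le> l" "(gstep ^^ n) (p l, b, W) (a', b', W')"
    and "W \<inter> part A p (Suc l) = {}"
  shows "a' = p l \<and> W' \<inter> part A p (Suc l) = {}"
  using assms(3)
proof (induction n arbitrary: a' b' W')
  case 0
  then show ?case using assms(4) by auto
next
  case (Suc n)
  then obtain c d U where "(gstep ^^ n) (p l, b, W) (c, d, U)" and s: "gstep (c, d, U) (a', b', W')"
    by (auto elim!: relpowp_Suc_E)
  with Suc have U: "c = p l" "U \<inter> part A p (Suc l) = {}" by auto
  have s': "step (p l, d, U) (p l, b', W')" "a' = p l" using s U by (auto simp: gstep_def)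
  have "v \<notin> W'" if v: "v \<in> part A p (Suc l)" for v
  proof (cases "v = p l")
    case True
    then show ?thesis using s' by auto
  next
    case False
    then have v': "v \<in> part A p l" using v by (auto simp: part_def less_Suc_eq)
    show ?thesis
      using s' U v part_neighbours[OF assms(1,2) _ v'] by auto
  qed
  then show ?case using s' by auto
qed

section \<open>Joining three branches at a root\<close>

lemma clearable_sweep:
  assumes "branch A p l" "clearable A (p 0) \<tau>" "p l = r" "a \<in> insert h V" "b \<in> insert h V"
  shows "\<exists>n b' W'. n \<le> \<tau> + l \<and> (step ^^ n) (a, b, W) (r, b', W') \<and>
    W' \<inter> part A p (Suc l) = {} \<and> r \<in> insert h V \<and> b' \<in> insert h V"
proof -
  obtain n b' U where U: "n \<le> \<tau>" "(step ^^ n) (a, b, W) (p 0, b', U)" "U \<inter> A = {}"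
    using assms unfolding clearable_def by metis
  obtain W' where W': "(gstep ^^ l) (b', p 0, U) (b', r, W')" "W' \<inter> part A p (Suc l) = {}"
    using part_sweep[OF assms(1) U(3)] assms(3) by blast
  \<comment> \<open>Clearing leaves the first lion on \<open>p 0\<close>, whereas sweeps move the
    second one; hence the exchange of roles.\<close>
  have "(step ^^ l) (p 0, b', U) (r, b', W')"
    using W'(1) relpowp_gstep relpowp_swap by blast
  then have *: "(step ^^ (n + l)) (a, b, W) (r, b', W')"
    using U(2) by (auto simp: relpowp_add)
  have "n + l \<le> \<tau> + l" using U(1) by simp
  with * W'(2) relpowp_positions[OF * assms(4,5)] show ?thesis by blast
qed

text \<open>The jump to \<open>p 0\<close> takes two steps and costs at most two path vertices;
  \<open>3 \<le> M\<close> therefore leaves index 1, that is \<open>A\<close>, clean for the new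
  sweep.\<close>

lemma resweep:
  assumes "branch A p l" "W \<inter> part A p M = {}" "3 \<le> M" "M \<le> Suc l"
    "b \<in> insert h V" "p 0 \<in> V" "p l = r"
  shows "\<exists>W'. (gstep ^^ (2 + l)) (c, b, W) (c, r, W') \<and> W' \<inter> part A p (Suc l) = {}"
proof -
  obtain U where U: "(gstep ^^ 2) (c, b, W) (c, p 0, U)"
    using teleport_guarded[OF assms(5), of "p 0" c W] assms(6) by auto
  have "U \<inter> part A p 1 = {}"
    using part_decay[OF assms(1) relpowp_gstep[OF U] assms(2), of 1] assms by simp
  then have "U \<inter> A = {}" using part_1[OF assms(1)] by simp
  from part_sweep[OF assms(1) this order.refl, of c] obtain W' where
    "(gstep ^^ l) (c, p 0, U) (c, r, W')" "W' \<inter> part A p (Suc l) = {}"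
    using assms(7) by auto
  then show ?thesis using U by (metis relcomppI relpowp_add)
qed

text \<open>Branches are cleared in the order 2, 1, 0. The length \<open>l 1\<close> covers the time
  for branch 0 and one jump; \<open>l 2\<close> covers the times for branches 1 and 0, the second
  sweep of branch 1 and two jumps.\<close>

lemma clearable_join:
  fixes A :: "nat \<Rightarrow> 'a set"
  assumes br: "\<And>i. i < 3 \<Longrightarrow> branch (A i) (p i) (l i)"
    and cl: "\<And>i. i < 3 \<Longrightarrow> clearable (A i) (p i 0) (\<tau> i)"
    and r: "\<And>i. i < 3 \<Longrightarrow> p i (l i) = r" and AV: "\<And>i. i < 3 \<Longrightarrow> A i \<subseteq> V"
    and l: "1 \<le> l 0" "\<tau> 0 + l 0 + 2 \<le> l 1" "\<tau> 0 + l 0 + \<tau> 1 + 2 * l 1 + 4 \<le> l 2"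
  shows "clearable (\<Union>i<3. part (A i) (p i) (Suc (l i))) r
    (\<tau> 0 + l 0 + \<tau> 1 + 2 * l 1 + 4 + \<tau> 2 + 2 * l 2)"
  unfolding clearable_def
proof (intro allI impI)
  fix a b W assume ab: "a \<in> insert h V" "b \<in> insert h V"
  have lt3: "0 < (3::nat)" "1 < (3::nat)" "2 < (3::nat)" by auto
  let ?P = "\<lambda>i. part (A i) (p i)"
  obtain n2 b2 W2 where 2: "n2 \<le> \<tau> 2 + l 2" "(step ^^ n2) (a, b, W) (r, b2, W2)"
    "W2 \<inter> ?P 2 (Suc (l 2)) = {}" "r \<in> insert h V" "b2 \<in> insert h V"
    using clearable_sweep[OF br[of 2] cl[of 2] r[of 2] ab] by (metis (no_types, lifting) lt3)
  obtain n1 b1 W1 where 1: "n1 \<le> \<tau> 1 + l 1" "(step ^^ n1) (r, b2, W2) (r, b1, W1)"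
    "W1 \<inter> ?P 1 (Suc (l 1)) = {}" "b1 \<in> insert h V"
    using clearable_sweep[OF br[of 1] cl[of 1] r[of 1] 2(4,5)] by (metis (no_types, lifting) lt3)
  obtain n0 b0 W0 where 0: "n0 \<le> \<tau> 0 + l 0" "(step ^^ n0) (r, b1, W1) (r, b0, W0)"
    "W0 \<inter> ?P 0 (Suc (l 0)) = {}" "b0 \<in> insert h V"
    using clearable_sweep[OF br[of 0] cl[of 0] r[of 0] 2(4) 1(4)] by (metis (no_types, lifting) lt3)
  have p0: "p i 0 \<in> V" if "i < 3" for i using br[OF that] AV[OF that] by (auto simp: branch_def)
  \<comment> \<open>Branch 1 was exposed for the \<open>n0\<close> steps spent on branch 0.\<close>
  have 3: "W0 \<inter> ?P 1 (Suc (l 1) - n0) = {}"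
    by (rule part_decay[OF br[of 1] 0(2) 1(3)]) (use 0 l in auto)
  have M1: "3 \<le> Suc (l 1) - n0" using 0(1) l(2) by linarith
  obtain W' where W': "(gstep ^^ (2 + l 1)) (r, b0, W0) (r, r, W')" "W' \<inter> ?P 1 (Suc (l 1)) = {}"
    using resweep[OF br[OF lt3(2)] 3 M1 _ 0(4) p0[OF lt3(2)] r[OF lt3(2)], of r] by fastforce
  have steps: "(step ^^ (n1 + n0 + (2 + l 1))) (r, b2, W2) (r, r, W')"
    using 1(2) 0(2) relpowp_gstep[OF W'(1)] unfolding relpowp_add by blast
  \<comment> \<open>Branch 2 was exposed during both later clearings and the second sweep of branch
    1.\<close>
  have 4: "W' \<inter> ?P 2 (Suc (l 2) - (n1 + n0 + (2 + l 1))) = {}"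
    by (rule part_decay[OF br[of 2] steps 2(3)]) (use 0 1 l in auto)
  have 5: "W' \<inter> ?P 0 (Suc (l 0)) = {}"
    using part_guarded[OF br[of 0] l(1), of "2 + l 1" b0 W0 r r W'] W' 0 r by auto
  have M2: "3 \<le> Suc (l 2) - (n1 + n0 + (2 + l 1))" using 0(1) 1(1) l by linarith
  obtain W'' where W'': "(gstep ^^ (2 + l 2)) (r, r, W') (r, r, W'')" "W'' \<inter> ?P 2 (Suc (l 2)) = {}"
    using resweep[OF br[OF lt3(3)] 4 M2 _ 2(4) p0[OF lt3(3)] r[OF lt3(3)], of r] by fastforce
  have 6: "W'' \<inter> ?P 0 (Suc (l 0)) = {}"
    using part_guarded[OF br[of 0] l(1), of "2 + l 2" r W' r r W''] W'' 5 r by auto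
  have 7: "W'' \<inter> ?P 1 (Suc (l 1)) = {}"
    using part_guarded[OF br[of 1], of "2 + l 2" r W' r r W''] W'' W' r l by auto
  have "(step ^^ (n2 + n1 + n0 + (2 + l 1) + (2 + l 2))) (a, b, W) (r, r, W'')"
    using 2(2) 1(2) 0(2) relpowp_gstep[OF W'(1)] relpowp_gstep[OF W''(1)]
    unfolding relpowp_add by blast
  moreover have "n2 + n1 + n0 + (2 + l 1) + (2 + l 2) \<le> \<tau> 0 + l 0 + \<tau> 1 + 2 * l 1 + 4 + \<tau> 2 + 2 * l 2"
    using 0(1) 1(1) 2(1) by linarith
  moreover have "W'' \<inter> (\<Union>i<3. ?P i (Suc (l i))) = {}"
    using 6 7 W''(2) by (auto simp: numeral_3_eq_3 less_Suc_eq numeral_2_eq_2)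
  ultimately show "\<exists>n\<le>\<tau> 0 + l 0 + \<tau> 1 + 2 * l 1 + 4 + \<tau> 2 + 2 * l 2. \<exists>b' W'.
      (step ^^ n) (a, b, W) (r, b', W') \<and> W' \<inter> (\<Union>i<3. ?P i (Suc (l i))) = {}"
    by blast
qed

section \<open>From runs of states to lion strategies\<close>

lemma lion_number_cone:
  assumes "clearable V r \<tau>"
  shows "lion_number cone \<le> 3"
proof -
  \<comment> \<open>All lions start on the apex, which makes \<open>V\<close> the initial
    contaminated set.\<close>
  obtain n b' W' where n: "(step ^^ n) (h, h, V) (r, b', W')" "W' \<inter> V = {}"
    using assms unfolding clearable_def by blast
  then obtain f where f: "f 0 = (h, h, V)" "f n = (r, b', W')" "\<forall>i<n. step (f i) (f (Suc i))"
    unfolding relpowp_fun_conv by blast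
  \<comment> \<open>A strategy is defined for all times; \<open>min t n\<close> freezes the lions
    once the run has ended.\<close>
  define p where "p i t = (let s = f (min t n) in
    if i = (0::nat) then fst s else if i = 1 then fst (snd s) else h)" for i t
  have less3: "i < 3 \<longleftrightarrow> i = 0 \<or> i = 1 \<or> i = (2::nat)" for i by auto
  have p2: "p 2 t = h" for t by (simp add: p_def)
  have lset: "lion_set 3 p t = {p 0 t, p 1 t, h}" for t
    unfolding lion_set_def less3 p2[of t, symmetric] by blast
  have lmov: "lion_moves 3 p t = {(p 0 t, p 0 (Suc t)), (p 1 t, p 1 (Suc t)), (h, h)}" for t
    unfolding lion_moves_def less3 using p2[of t] p2[of "Suc t"] by force
  have st: "step (p 0 t, p 1 t, snd (snd (f t))) (p 0 (Suc t), p 1 (Suc t), snd (snd (f (Suc t))))"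
    if "t < n" for t
    using f(3)[rule_format, OF that] that by (simp add: p_def Let_def min_def)
  have "lion_strategy cone 3 p"
    unfolding lion_strategy_def
  proof (intro conjI allI impI)
    fix i :: nat assume "i < 3"
    show "p i 0 \<in> pverts cone" using f(1) by (auto simp: p_def cone_def Let_def)
    show "p i (Suc t) \<in> {p i t} \<union> neighbours cone (p i t)" for t
    proof (cases "t < n")
      case True
      have "p 0 (Suc t) \<in> insert (p 0 t) (neighbours cone (p 0 t))"
        "p 1 (Suc t) \<in> insert (p 1 t) (neighbours cone (p 1 t))"
        using st[OF True] unfolding step.simps by blast+
      moreover have "i = 0 \<or> i = 1 \<or> i = 2" using \<open>i < 3\<close> less3 by blast
      ultimately show ?thesis using p2 by auto
    next
      case False
      then show ?thesis by (simp add: p_def min_def)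
    qed
  qed
  moreover have "contaminated cone 3 p t = snd (snd (f t)) \<and> snd (snd (f t)) \<subseteq> V" if "t \<le> n" for t
    using that
  proof (induction t)
    case 0
    have "p 0 0 = h" "p 1 0 = h" using f(1) by (simp_all add: p_def)
    then show ?case using f(1) hV by (auto simp: lset cone_def)
  next
    case (Suc t)
    let ?W = "snd (snd (f t))"
    have IH: "contaminated cone 3 p t = ?W" "?W \<subseteq> V" using Suc by auto
    have s: "snd (snd (f (Suc t))) = {v \<in> V - {p 0 (Suc t), p 1 (Suc t)}. v \<in> ?W \<or>
       (\<exists>w\<in>?W. (v, w) \<in> F \<and> (v, w) \<notin> {(p 0 t, p 0 (Suc t)), (p 1 t, p 1 (Suc t))} \<and>
          (w, v) \<notin> {(p 0 t, p 0 (Suc t)), (p 1 t, p 1 (Suc t))})}"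
      using st[of t] Suc.prems by simp
    \<comment> \<open>The apex is occupied at all times and never contaminated, so edges at
      \<open>h\<close> drop out of the spreading rule.\<close>
    show ?case
      unfolding contaminated.simps IH(1) lset lmov s using IH(2) hV
      by (auto simp: cone_def neighbours_def)
  qed
  then have "clears cone 3 p"
    unfolding clears_def using f(2) n(2) by (intro exI[of _ n]) force
  ultimately show ?thesis
    unfolding lion_number_def by (intro Least_le) auto
qed

end

section \<open>A lower bound for the pathwidth\<close>

definition connected_on :: "('a \<times> 'a) set \<Rightarrow> 'a set \<Rightarrow> bool" where
  "connected_on E C \<longleftrightarrow> (\<forall>u\<in>C. \<forall>v\<in>C. (u, v) \<in> (E \<inter> C \<times> C)\<^sup>*)"

lemma connected_on_union:
  assumes "connected_on E C" "connected_on E D" "x \<in> C" "x \<in> D"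
  shows "connected_on E (C \<union> D)"
proof -
  let ?R = "(E \<inter> (C \<union> D) \<times> (C \<union> D))\<^sup>*"
  have sub: "(E \<inter> C \<times> C)\<^sup>* \<subseteq> ?R" "(E \<inter> D \<times> D)\<^sup>* \<subseteq> ?R"
    by (intro rtrancl_mono; auto)+
  have "(u, x) \<in> ?R \<and> (x, u) \<in> ?R" if "u \<in> C \<union> D" for u
    using that assms sub unfolding connected_on_def by blast
  then show ?thesis
    unfolding connected_on_def by (meson rtrancl_trans)
qed

lemma connected_on_insert:
  assumes "connected_on E C" "x \<in> C" "(x, y) \<in> E" "(y, x) \<in> E"
  shows "connected_on E (insert y C)"
proof -
  have "connected_on E {x, y}"
    using assms(3,4) unfolding connected_on_def by auto
  from connected_on_union[OF assms(1) this assms(2)] have "connected_on E (C \<union> {x, y})" by simp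
  moreover have "C \<union> {x, y} = insert y C" using assms(2) by auto
  ultimately show ?thesis by simp
qed

lemma connected_on_mono: "connected_on E C \<Longrightarrow> E \<subseteq> E' \<Longrightarrow> connected_on E' C"
  unfolding connected_on_def by (meson Int_mono order_refl rtrancl_mono subsetD)

text \<open>If bag \<open>j\<close> missed \<open>C\<close>, no vertex of \<open>C\<close> could
  occur on both sides of it, while adjacent vertices share a bag; so no walk in \<open>C\<close>
  could get past.\<close>

lemma connected_on_meets_bag:
  assumes pd: "path_decomposition G Xs" and C: "connected_on (parcs G) C"
    and ijl: "i \<le> j" "j \<le> l" "l < length Xs" and u: "u \<in> C \<inter> Xs ! i" and v: "v \<in> C \<inter> Xs ! l"
  shows "C \<inter> Xs ! j \<noteq> {}"
proof
  assume empty: "C \<inter> Xs ! j = {}"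
  have conv: "Xs ! a \<inter> Xs ! c \<subseteq> Xs ! b" if "a \<le> b" "b \<le> c" "c < length Xs" for a b c
    using pd that by (auto simp: path_decomposition_def)
  have "(u, v) \<in> (parcs G \<inter> C \<times> C)\<^sup>*" using C u v by (auto simp: connected_on_def)
  \<comment> \<open>Invariant along the walk: the current vertex occurs strictly before bag
    \<open>j\<close>.\<close>
  then have "v \<in> C \<and> (\<exists>m<j. v \<in> Xs ! m)"
  proof (induction rule: rtrancl_induct)
    case base
    then show ?case using u empty ijl by (cases "i = j") auto
  next
    case (step x y)
    then obtain m where m: "m < j" "x \<in> Xs ! m" by auto
    obtain q where q: "q < length Xs" "x \<in> Xs ! q" "y \<in> Xs ! q"
      using step(2) pd unfolding path_decomposition_def by (force simp: in_set_conv_nth)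
    have "q < j"
    proof (rule ccontr)
      assume "\<not> q < j"
      then have "x \<in> Xs ! j" using conv[of m j q] m q by auto
      then show False using step empty by auto
    qed
    then show ?case using q step by auto
  qed
  then obtain m where "m < j" "v \<in> Xs ! m" by auto
  then have "v \<in> Xs ! j" using conv[of m j l] v ijl by auto
  then show False using empty v by auto
qed

text \<open>Measuring bags of the whole graph against \<open>A\<close> lets bounds for several
  subsets apply to one and the same decomposition.\<close>

definition thick :: "'a pair_pre_digraph \<Rightarrow> nat \<Rightarrow> 'a set \<Rightarrow> bool" where
  "thick G k A \<longleftrightarrow> (\<forall>Xs. path_decomposition G Xs \<longrightarrow> (\<exists>X\<in>set Xs. k \<le> card (X \<inter> A)))"

text \<open>By \<open>1 \<le> k\<close> the two outer bags meet \<open>C\<close>, so the middle bag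
  does too; as \<open>C\<close> avoids the middle copy, the vertex found there is not among the
  \<open>k\<close> counted already.\<close>

lemma thick_join:
  fixes A :: "nat \<Rightarrow> 'a set"
  assumes th: "\<And>i. i < 3 \<Longrightarrow> thick G k (A i)" and k: "1 \<le> k" and fin: "finite B"
    and AB: "\<And>i. i < 3 \<Longrightarrow> A i \<subseteq> B"
    and conn: "\<And>a b c. {a, b, c} = {..<3} \<Longrightarrow>
      \<exists>C. connected_on (parcs G) C \<and> A a \<union> A c \<subseteq> C \<and> C \<subseteq> B - A b"
  shows "thick G (Suc k) B"
  unfolding thick_def
proof (intro allI impI)
  fix Xs assume pd: "path_decomposition G Xs"
  have "\<exists>t<length Xs. k \<le> card (Xs ! t \<inter> A i)" if "i < 3" for i
    using th[OF that] pd unfolding thick_def by (metis in_set_conv_nth)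
  then obtain t where t: "\<And>i. i < 3 \<Longrightarrow> t i < length Xs" "\<And>i. i < 3 \<Longrightarrow> k \<le> card (Xs ! t i \<inter> A i)"
    by metis
  \<comment> \<open>The three bags may come in any order; \<open>conn\<close> covers every
    permutation.\<close>
  have "\<exists>a b c. {a, b, c} = {..<3::nat} \<and> t a \<le> t b \<and> t b \<le> t c"
  proof -
    have "{0,1,2} = {..<3::nat}" "{0,2,1} = {..<3::nat}" "{1,0,2} = {..<3::nat}"
      "{1,2,0} = {..<3::nat}" "{2,0,1} = {..<3::nat}" "{2,1,0} = {..<3::nat}" by auto
    then show ?thesis by (metis linear)
  qed
  then obtain a b c where abc: "{a, b, c} = {..<3::nat}" "t a \<le> t b" "t b \<le> t c" by blast
  then have lt: "a < 3" "b < 3" "c < 3" by auto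
  obtain C where C: "connected_on (parcs G) C" "A a \<union> A c \<subseteq> C" "C \<subseteq> B - A b"
    using conn[OF abc(1)] by blast
  have ne: "Xs ! t i \<inter> A i \<noteq> {}" if "i < 3" for i
    using t(2)[OF that] k by auto
  obtain u v where "u \<in> C \<inter> Xs ! t a" "v \<in> C \<inter> Xs ! t c" using ne lt C(2) by blast
  from connected_on_meets_bag[OF pd C(1) abc(2,3) t(1)[OF lt(3)] this]
  obtain w where w: "w \<in> C" "w \<in> Xs ! t b" by blast
  have "Suc k \<le> Suc (card (Xs ! t b \<inter> A b))" using t(2)[OF lt(2)] by simp
  also have "\<dots> = card (insert w (Xs ! t b \<inter> A b))"
    using w C(3) fin AB[OF lt(2)] by (subst card_insert_disjoint) (auto intro: finite_subset)
  also have "\<dots> \<le> card (Xs ! t b \<inter> B)"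
    using w C(3) fin AB[OF lt(2)] by (intro card_mono) auto
  finally show "\<exists>X\<in>set Xs. Suc k \<le> card (X \<inter> B)" using t(1)[OF lt(2)] by auto
qed

lemma thick_pathwidth:
  assumes "pair_graph G" "thick G (Suc k) A"
  shows "int k \<le> pathwidth G"
proof -
  interpret pair_graph G by fact
  obtain Xs where Xs: "path_decomposition G Xs" "decomposition_width Xs = pathwidth G"
    using pathwidth_attained[OF assms(1)] by blast
  then obtain X where X: "X \<in> set Xs" "Suc k \<le> card (X \<inter> A)" using assms(2) by (auto simp: thick_def)
  have "X \<subseteq> pverts G" using Xs X by (auto simp: path_decomposition_def)
  then have "card (X \<inter> A) \<le> card X" by (intro card_mono) (auto intro: finite_subset)
  also have "\<dots> \<le> Max (card ` set Xs)" using X by auto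
  finally show ?thesis using X Xs by (auto simp: decomposition_width_def)
qed

section \<open>The recursive construction\<close>

text \<open>
  Thickness and clearability are required in every graph that contains the tree and, apart from
  the apex, is attached to it only at the root; so they survive the embedding into larger trees.
\<close>

definition lion_tree :: "nat \<Rightarrow> 'a set \<Rightarrow> ('a \<times> 'a) set \<Rightarrow> 'a \<Rightarrow> nat \<Rightarrow> bool" where
  "lion_tree k A E r \<tau> \<longleftrightarrow> finite A \<and> r \<in> A \<and> E \<subseteq> A \<times> A \<and> sym E \<and> irrefl E \<and> connected_on E A \<and>
     (\<forall>G. E \<subseteq> parcs G \<longrightarrow> A \<subseteq> pverts G \<longrightarrow> thick G k A) \<and>
     (\<forall>V F h. cone_game V F h \<longrightarrow> A \<subseteq> V \<longrightarrow> E \<subseteq> F \<longrightarrow> (\<forall>v\<in>A - {r}. F `` {v} \<subseteq> E `` {v}) \<longrightarrow>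
        cone_game.clearable V F h A r \<tau>)"

text \<open>The time 2 is that of one jump through the apex.\<close>

lemma lion_tree_singleton: "lion_tree 1 {r} {} r 2"
proof -
  have "thick G 1 {r}" if "{r} \<subseteq> pverts G" for G
    unfolding thick_def
  proof (intro allI impI)
    fix Xs assume "path_decomposition G Xs"
    then have "r \<in> \<Union> (set Xs)" using that by (simp add: path_decomposition_def)
    then obtain X where "X \<in> set Xs" "r \<in> X" by blast
    then show "\<exists>X\<in>set Xs. 1 \<le> card (X \<inter> {r})" by (intro bexI[of _ X]) auto
  qed
  then show ?thesis
    by (auto simp: lion_tree_def connected_on_def cone_game.clearable_singleton irrefl_def sym_def)
qed

lemma lion_tree_join:
  fixes A :: "nat \<Rightarrow> nat set"
  assumes T: "\<And>i. i < 3 \<Longrightarrow> lion_tree k (A i) (E i) (q i) (\<tau> i)" and k: "1 \<le> k"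
    and disj: "\<And>i j. i < 3 \<Longrightarrow> j < 3 \<Longrightarrow> i \<noteq> j \<Longrightarrow> A i \<inter> A j = {}"
    and less: "\<And>i v. i < 3 \<Longrightarrow> v \<in> A i \<Longrightarrow> v < r"
  shows "\<exists>B E' \<tau>'. lion_tree (Suc k) B E' r \<tau>' \<and> B \<subseteq> (\<Union>i<3. A i) \<union> {r..}"
proof -
  \<comment> \<open>The least lengths that meet the timing conditions of
    \<open>clearable_join\<close>.\<close>
  define l where "l i = (if i = 0 then 1 else if i = 1 then \<tau> 0 + 3
    else \<tau> 0 + 1 + \<tau> 1 + 2 * (\<tau> 0 + 3) + 4)" for i :: nat
  \<comment> \<open>Inner path vertices get numbers above \<open>r\<close> whose offset has residue
    \<open>i\<close> modulo 3, so they are distinct from each other, from \<open>r\<close> and from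
    the copies. From index \<open>l i\<close> on the value is the root.\<close>
  define p where "p i j = (if j = 0 then q i else if j < l i then r + 3 * j + i else r)" for i j
  define P where "P i = {(p i j, p i (Suc j)) | j. j < l i}" for i
  define E' where "E' = (\<Union>i<3. E i \<union> P i \<union> (P i)\<inverse>)"
  define D where "D i = part (A i) (p i)" for i
  define B where "B = (\<Union>i<3. D i (Suc (l i)))"
  have l1: "1 \<le> l i" for i by (simp add: l_def)
  have pl: "p i (l i) = r" for i using l1[of i] by (simp add: p_def)
  have p0: "p i 0 = q i" for i by (simp add: p_def)
  have pge: "r \<le> p i j" if "0 < j" for i j using that by (simp add: p_def)
  have T': "finite (A i)" "q i \<in> A i" "E i \<subseteq> A i \<times> A i" "sym (E i)" "irrefl (E i)"
    "connected_on (E i) (A i)" if "i < 3" for i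
    using T[OF that] by (auto simp: lion_tree_def)
  have pinj: "i = i' \<and> j = j'"
    if "p i j = p i' j'" "i < 3" "i' < 3" "0 < j" "j < l i" for i i' j j'
  proof -
    have "q i' < r" using T'(2) less that by blast
    then have "r + 3 * j + i = r + 3 * j' + i'"
      using that by (auto simp: p_def split: if_splits)
    then have "3 * j + i = 3 * j' + i'" by simp
    with that(2,3) show ?thesis by presburger
  qed
  \<comment> \<open>Copies lie below \<open>r\<close> and all later path vertices at or above it, so
    a copy is left only from \<open>q i\<close> along its first path edge.\<close>
  have edgeA: "(v, w) \<in> E i \<or> v = q i \<and> w = p i 1"
    if e: "(v, w) \<in> E'" and v: "v \<in> A i" and i: "i < 3" for v w i
  proof -
    obtain i' where i': "i' < 3" and e': "(v, w) \<in> E i' \<union> P i' \<union> (P i')\<inverse>"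
      using e by (auto simp: E'_def)
    have same: "i' = i" if "v \<in> A i'" using that v i i' disj by blast
    have vr: "v < r" using less v i by blast
    consider "(v, w) \<in> E i'" | "(v, w) \<in> P i'" | "(w, v) \<in> P i'" using e' by blast
    then show ?thesis
    proof cases
      case 1
      then show ?thesis using same T'(3)[OF i'] by auto
    next
      case 2
      then obtain j where j: "v = p i' j" "w = p i' (Suc j)" by (auto simp: P_def)
      then have "j = 0" using pge[of j i'] vr by (cases j) auto
      then show ?thesis using j p0[of i'] same T'(2)[OF i'] by auto
    next
      case 3
      then obtain j where "v = p i' (Suc j)" by (auto simp: P_def)
      then show ?thesis using pge[of "Suc j" i'] vr by auto
    qed
  qed
  have edgeP: "w \<in> {p i (j - 1), p i (Suc j)}"
    if e: "(p i j, w) \<in> E'" and i: "i < 3" and j: "0 < j" "j < l i" for i j w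
  proof -
    obtain i' where i': "i' < 3" and e': "(p i j, w) \<in> E i' \<union> P i' \<union> (P i')\<inverse>"
      using e by (auto simp: E'_def)
    have "p i j \<notin> A i'" using pge[OF j(1), of i] less[OF i'] by fastforce
    then consider "(p i j, w) \<in> P i'" | "(w, p i j) \<in> P i'" using e' T'(3)[OF i'] by blast
    then show ?thesis
    proof cases
      case 1
      then show ?thesis using pinj[OF _ i i' j] by (auto simp: P_def)
    next
      case 2
      then obtain j' where "w = p i' j'" "p i j = p i' (Suc j')" by (auto simp: P_def)
      then show ?thesis using pinj[OF _ i i' j, of "Suc j'"] by auto
    qed
  qed
  have path: "(p i j, p i (Suc j)) \<in> E'" "(p i (Suc j), p i j) \<in> E'" if "i < 3" "j < l i" for i j
    using that by (auto simp: E'_def P_def)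
  have EE': "E i \<subseteq> E'" if "i < 3" for i using that by (auto simp: E'_def)
  have Dconn: "connected_on E' (D i (Suc m))" if "i < 3" "m \<le> l i" for i m
    using that(2)
  proof (induction m)
    case 0
    have "D i (Suc 0) = A i" using p0 T'(2)[OF that(1)] by (auto simp: D_def part_def)
    then show ?case using connected_on_mono[OF T'(6) EE'] that by simp
  next
    case (Suc m)
    have "D i (Suc (Suc m)) = insert (p i (Suc m)) (D i (Suc m))"
      by (auto simp: D_def part_def less_Suc_eq)
    moreover have "p i m \<in> D i (Suc m)" by (auto simp: D_def part_def)
    ultimately show ?case
      using connected_on_insert[OF _ _ path[OF that(1), of m]] Suc by simp
  qed
  have rD: "r \<in> D i (Suc (l i))" for i using pl[of i] by (force simp: D_def part_def)
  have AD: "A i \<subseteq> D i m" for i m by (auto simp: D_def part_def)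
  have Dsub: "D i m \<subseteq> A i \<union> {r..}" if "i < 3" for i m
  proof -
    have "p i j \<in> A i \<union> {r..}" for j
      using pge[of j i] p0[of i] T'(2)[OF that] by (cases "j = 0") auto
    then show ?thesis by (auto simp: D_def part_def)
  qed
  have pD: "p i j \<in> B" if "i < 3" "j \<le> l i" for i j
    using that unfolding B_def D_def part_def by (auto simp: less_Suc_eq_le intro!: bexI[of _ i])
  have AB: "A i \<subseteq> B" if "i < 3" for i using AD[of i "Suc (l i)"] that by (auto simp: B_def)
  have finB: "finite B" using T'(1) by (auto simp: B_def D_def part_def)
  have E'B: "E' \<subseteq> B \<times> B"
  proof -
    have "E i \<subseteq> B \<times> B" if "i < 3" for i using T'(3)[OF that] AB[OF that] by blast
    moreover have "P i \<subseteq> B \<times> B" if "i < 3" for i using pD[OF that] by (auto simp: P_def)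
    ultimately show ?thesis unfolding E'_def by blast
  qed
  have symE': "sym E'" using T'(4) unfolding E'_def sym_def by blast
  have irrE': "irrefl E'"
  proof -
    have "p i j \<noteq> p i (Suc j)" if "i < 3" "j < l i" for i j
      using pinj[of i j i "Suc j"] that pge[of "Suc j" i] p0[of i] less[OF that(1) T'(2)[OF that(1)]]
      by (cases "j = 0") auto
    then show ?thesis using T'(5) unfolding E'_def irrefl_def P_def by blast
  qed
  have B3: "B = D 0 (Suc (l 0)) \<union> D 1 (Suc (l 1)) \<union> D 2 (Suc (l 2))"
    by (auto simp: B_def numeral_3_eq_3 lessThan_Suc numeral_2_eq_2)
  have connB: "connected_on E' B"
    unfolding B3 by (intro connected_on_union[where x = r] Dconn) (use rD in auto)
  have thickB: "thick G (Suc k) B" if G: "E' \<subseteq> parcs G" "B \<subseteq> pverts G" for G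
  proof (rule thick_join[OF _ k finB AB])
    show "thick G k (A i)" if "i < 3" for i
      using T[OF that] G EE'[OF that] AB[OF that] unfolding lion_tree_def by blast
  next
    fix a b c :: nat assume abc: "{a, b, c} = {..<3}"
    then have lt: "a < 3" "b < 3" "c < 3" by auto
    have "card {a, b, c} = 3" using abc by simp
    then have ne: "a \<noteq> b" "c \<noteq> b" by (auto simp: card_insert_if split: if_splits)
    \<comment> \<open>Both branches contain \<open>r\<close>, so their union is connected; its path
      vertices at or above \<open>r\<close> cannot meet \<open>A b\<close>.\<close>
    let ?C = "D a (Suc (l a)) \<union> D c (Suc (l c))"
    have "connected_on (parcs G) ?C"
      by (rule connected_on_mono[OF _ G(1)])
        (intro connected_on_union[where x = r] Dconn lt rD order.refl)
    moreover have "A a \<union> A c \<subseteq> ?C" using AD by blast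
    moreover have "?C \<subseteq> B - A b"
    proof -
      have "D i (Suc (l i)) \<inter> A b = {}" if "i < 3" "i \<noteq> b" for i
        using Dsub[OF that(1), of "Suc (l i)"] disj[OF that(1) lt(2) that(2)] less[OF lt(2)]
        by fastforce
      then show ?thesis using lt ne by (auto simp: B_def)
    qed
    ultimately show "\<exists>C. connected_on (parcs G) C \<and> A a \<union> A c \<subseteq> C \<and> C \<subseteq> B - A b" by blast
  qed
  define \<tau>' where "\<tau>' = \<tau> 0 + l 0 + \<tau> 1 + 2 * l 1 + 4 + \<tau> 2 + 2 * l 2"
  have clearB: "cone_game.clearable V F h B r \<tau>'"
    if cg: "cone_game V F h" and BV: "B \<subseteq> V" and EF: "E' \<subseteq> F"
      and FE: "\<forall>v\<in>B - {r}. F `` {v} \<subseteq> E' `` {v}" for V F h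
  proof -
    interpret cone_game V F h by (fact cg)
    have FE': "(v, w) \<in> E'" if "v \<in> B" "v \<noteq> r" "(v, w) \<in> F" for v w
      using FE that by blast
    \<comment> \<open>Vertices of a copy differ from \<open>r\<close>, so inside \<open>F\<close>
      the copy is still attached only at its own root. This serves both the assumption on the copy
      and the branch conditions.\<close>
    have FA: "(v, w) \<in> E i \<or> v = q i \<and> w = p i 1" if "i < 3" "v \<in> A i" "(v, w) \<in> F" for i v w
      using edgeA[OF FE' that(2,1)] that AB[OF that(1)] less[OF that(1,2)] by blast
    show ?thesis
      unfolding \<tau>'_def B_def D_def
    proof (rule clearable_join)
      fix i :: nat assume i: "i < 3"
      show "A i \<subseteq> V" using AB[OF i] BV by blast
      show "p i (l i) = r" by (rule pl)
      have "F `` {v} \<subseteq> E i `` {v}" if "v \<in> A i - {q i}" for v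
        using FA[OF i] that by blast
      then show "clearable (A i) (p i 0) (\<tau> i)"
        using T[OF i] cg BV AB[OF i] EF EE'[OF i] unfolding lion_tree_def p0 by blast
      show "branch (A i) (p i) (l i)"
        unfolding branch_def
      proof (intro conjI ballI allI impI)
        show "p i 0 \<in> A i" using T'(2)[OF i] p0 by simp
        show "F `` {v} \<subseteq> A i" if "v \<in> A i - {p i 0}" for v
          using FA[OF i] that T'(3)[OF i] unfolding p0 by blast
        show "F `` {p i 0} \<subseteq> A i \<union> {p i 1}"
          using FA[OF i T'(2)[OF i]] T'(3)[OF i] unfolding p0 by blast
        show "F `` {p i j} \<subseteq> {p i (j - 1), p i (Suc j)}" if j: "0 < j \<and> j < l i" for j
        proof -
          have "p i j \<noteq> r" using j by (simp add: p_def)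
          then show ?thesis using edgeP[OF FE' i] j pD[OF i, of j] by auto
        qed
        show "(p i j, p i (Suc j)) \<in> F" if "j < l i" for j using path(1)[OF i that] EF by blast
      qed
    qed (auto simp: l_def)
  qed
  have "lion_tree (Suc k) B E' r \<tau>'"
    unfolding lion_tree_def
    using finB E'B symE' irrE' connB thickB clearB rD[of 0] by (auto simp: B3)
  moreover have "B \<subseteq> (\<Union>i<3. A i) \<union> {r..}"
    using Dsub unfolding B_def by fastforce
  ultimately show ?thesis by blast
qed

text \<open>The free lower bound \<open>n\<close> allows the three trees to be placed in successive
  disjoint ranges, with the new root above them.\<close>

lemma lion_tree_exists: "\<exists>A E r \<tau>. lion_tree (Suc k) A E r \<tau> \<and> A \<subseteq> {n::nat..}"
proof (induction k arbitrary: n)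
  case 0
  show ?case using lion_tree_singleton[of n] by (intro exI[of _ "{n}"]) auto
next
  case (Suc k)
  have above: "\<exists>A E r \<tau>. lion_tree (Suc k) A E r \<tau> \<and> A \<subseteq> {m..} \<and> (\<exists>M\<ge>m. A \<subseteq> {..<M})" for m :: nat
  proof -
    obtain A E r \<tau> where *: "lion_tree (Suc k) A E r \<tau>" "A \<subseteq> {m..}" using Suc[of m] by auto
    then have "finite A" by (simp add: lion_tree_def)
    then obtain M where "A \<subseteq> {..<M}" using finite_nat_iff_bounded by blast
    then have "A \<subseteq> {..<max m M}" by auto
    with * show ?thesis by (meson max.cobounded1)
  qed
  obtain A0 E0 r0 \<tau>0 m0 where 0: "lion_tree (Suc k) A0 E0 r0 \<tau>0" "A0 \<subseteq> {n..}" "n \<le> m0" "A0 \<subseteq> {..<m0}"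
    using above by blast
  obtain A1 E1 r1 \<tau>1 m1 where 1: "lion_tree (Suc k) A1 E1 r1 \<tau>1" "A1 \<subseteq> {m0..}" "m0 \<le> m1" "A1 \<subseteq> {..<m1}"
    using above by blast
  obtain A2 E2 r2 \<tau>2 m2 where 2: "lion_tree (Suc k) A2 E2 r2 \<tau>2" "A2 \<subseteq> {m1..}" "m1 \<le> m2" "A2 \<subseteq> {..<m2}"
    using above by blast
  have less3: "i < 3 \<longleftrightarrow> i = 0 \<or> i = 1 \<or> i = (2::nat)" for i by auto
  define A where "A i = (if i = 0 then A0 else if i = 1 then A1 else A2)" for i :: nat
  have "\<exists>B E' \<tau>'. lion_tree (Suc (Suc k)) B E' m2 \<tau>' \<and> B \<subseteq> (\<Union>i<3. A i) \<union> {m2..}"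
  proof (rule lion_tree_join)
    show "lion_tree (Suc k) (A i) (if i = 0 then E0 else if i = 1 then E1 else E2)
      (if i = 0 then r0 else if i = 1 then r1 else r2)
      (if i = 0 then \<tau>0 else if i = 1 then \<tau>1 else \<tau>2)" for i
      using 0 1 2 by (simp add: A_def)
    show "A i \<inter> A j = {}" if "i < 3" "j < 3" "i \<noteq> j" for i j
      using that 0 1 2 unfolding less3 A_def by fastforce
    show "v < m2" if "i < 3" "v \<in> A i" for i v
      using that 0 1 2 unfolding less3 A_def by fastforce
  qed simp
  moreover have "(\<Union>i<3. A i) \<union> {m2..} \<subseteq> {n..}"
    using 0 1 2 by (fastforce simp: A_def split: if_splits)
  ultimately show ?case by (meson subset_trans)
qed

theorem theorem17:
  fixes k :: nat
  assumes "k \<ge> 1"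
  shows "\<exists>G :: nat pair_pre_digraph.
    pair_graph G \<and> lion_number G \<le> 3 \<and> pathwidth G \<ge> int k"
proof -
  obtain A E r \<tau> where T: "lion_tree (Suc k) A E r \<tau>" and A: "A \<subseteq> {1::nat..}"
    using lion_tree_exists by blast
  \<comment> \<open>The tree avoids 0, which is thus free to be the apex; with \<open>F = E\<close>
    nothing else is attached to the tree.\<close>
  interpret cone_game A E 0
    using T A by unfold_locales (auto simp: lion_tree_def)
  have "clearable A r \<tau>"
    using T cone_game_axioms unfolding lion_tree_def by blast
  then have "lion_number cone \<le> 3" by (rule lion_number_cone)
  moreover have "E \<subseteq> parcs cone" "A \<subseteq> pverts cone" by (auto simp: cone_def)
  then have "thick cone (Suc k) A" using T unfolding lion_tree_def by blast
  then have "int k \<le> pathwidth cone" by (rule thick_pathwidth[OF pair_graph_cone])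
  ultimately show ?thesis using pair_graph_cone by blast
qed

end
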